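(* Let $n\geq 2$. The assignment $$\sigma_{i}\mapsto Id_{i-1}\oplus\begin{pmatrix}0 & 1\\ t & 0\end{pmatrix}\oplus Id_{n-i-1},\qquad \tau_{i}\mapsto Id_{i-1}\oplus\begin{pmatrix}0 & 1\\ 1 & 0\end{pmatrix}\oplus Id_{n-i-1}\qquad (1\leq i\leq n-1)$$ defines a representation $TYM:\mathbf{wB}_{n}\rightarrow GL_{n}(\mathbb{Z}[t^{\pm1}])$ of the welded braid group $\mathbf{wB}_n$. Taking the transpose of the inverse of the matrices $TYM(\sigma_i)$ and $TYM(\tau_i)$, $1\leq i\leq n-1$, defines a representation $TYM^{*}:\mathbf{wB}_{n}\rightarrow GL_{n}(\mathbb{Z}[t^{\pm1}])$, and $TYM^{*}$ is not equivalent to $TYM$.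
   Context: The welded braid group $\mathbf{wB}_{n}$ is the group with generators $\sigma_{i},\tau_{i}$, $1\leq i\leq n-1$, and relations: (1) $\sigma_{i}\sigma_{k}=\sigma_{k}\sigma_{i}$, $\tau_{i}\tau_{k}=\tau_{k}\tau_{i}$ and $\sigma_{i}\tau_{k}=\tau_{k}\sigma_{i}$ if $|i-k|\geq 2$; (2) $\sigma_{i}\sigma_{i+1}\sigma_{i}=\sigma_{i+1}\sigma_{i}\sigma_{i+1}$ and $\tau_{i}\tau_{i+1}\tau_{i}=\tau_{i+1}\tau_{i}\tau_{i+1}$ for $1\leq i\leq n-2$; (3) $\tau_{i}^{2}=1$ for $1\leq i\leq n-1$; (4) $\tau_{i}\sigma_{i+1}\sigma_{i}=\sigma_{i+1}\sigma_{i}\tau_{i+1}$ and $\sigma_{i}\tau_{i+1}\tau_{i}=\tau_{i+1}\tau_{i}\sigma_{i+1}$ for $1\leq i\leq n-2$. Products are read from right to left (as composition of maps). $Id_k$ is the $k\times k$ identity matrix and $\oplus$ denotes block-diagonal sum. *)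

theory Defs
  imports "Jordan_Normal_Form.Matrix" "HOL-Library.Poly_Mapping" "HOL-Library.FuncSet"
begin

text \<open>A letter \<open>(x, True)\<close> stands for the generator \<open>x\<close>, and \<open>(x, False)\<close> for its formal inverse.\<close>

type_synonym 'a word = "('a \<times> bool) list"

definition words :: "'a set \<Rightarrow> 'a word set" where
  "words X = lists (X \<times> UNIV)"

text \<open>The congruence on words over \<open>X\<close> generated by free cancellation and by the relations
  \<open>r = s\<close> for \<open>(r, s) \<in> R\<close>.\<close>

inductive_set pres_rel :: "'a set \<Rightarrow> ('a word \<times> 'a word) set \<Rightarrow> ('a word \<times> 'a word) set"
  for X :: "'a set" and R :: "('a word \<times> 'a word) set" where
  refl: "w \<in> words X \<Longrightarrow> (w, w) \<in> pres_rel X R"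
| sym: "(v, w) \<in> pres_rel X R \<Longrightarrow> (w, v) \<in> pres_rel X R"
| trans: "(u, v) \<in> pres_rel X R \<Longrightarrow> (v, w) \<in> pres_rel X R \<Longrightarrow> (u, w) \<in> pres_rel X R"
| cancel: "u \<in> words X \<Longrightarrow> v \<in> words X \<Longrightarrow> x \<in> X \<Longrightarrow>
    (u @ [(x, b), (x, \<not> b)] @ v, u @ v) \<in> pres_rel X R"
| rel: "u \<in> words X \<Longrightarrow> v \<in> words X \<Longrightarrow> r \<in> words X \<Longrightarrow> s \<in> words X \<Longrightarrow> (r, s) \<in> R \<Longrightarrow>
    (u @ r @ v, u @ s @ v) \<in> pres_rel X R"

definition presented_group :: "'a set \<Rightarrow> ('a word \<times> 'a word) set \<Rightarrow> 'a word set monoid" where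
  "presented_group X R =
    \<lparr>carrier = words X // pres_rel X R,
     mult = (\<lambda>A B. \<Union>a\<in>A. \<Union>b\<in>B. pres_rel X R `` {a @ b}),
     one = pres_rel X R `` {[]}\<rparr>"

definition pres_gen :: "'a set \<Rightarrow> ('a word \<times> 'a word) set \<Rightarrow> 'a \<Rightarrow> 'a word set" where
  "pres_gen X R x = pres_rel X R `` {[(x, True)]}"

lemma words_simps [simp]:
  "[] \<in> words X" "u @ v \<in> words X \<longleftrightarrow> u \<in> words X \<and> v \<in> words X"
  "(x, b) # u \<in> words X \<longleftrightarrow> x \<in> X \<and> u \<in> words X"
  by (auto simp: words_def)

lemma pres_rel_words: "(u, v) \<in> pres_rel X R \<Longrightarrow> u \<in> words X \<and> v \<in> words X"
  by (induction rule: pres_rel.induct) auto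

lemma equiv_pres_rel: "equiv (words X) (pres_rel X R)"
  by (rule equivI) (auto simp: refl_on_def sym_def trans_def pres_rel_words
      intro: pres_rel.intros)

lemma pres_rel_context:
  assumes "(a, b) \<in> pres_rel X R" "p \<in> words X" "q \<in> words X"
  shows "(p @ a @ q, p @ b @ q) \<in> pres_rel X R"
  using assms
proof (induction rule: pres_rel.induct)
  case (cancel u v x b)
  then show ?case using pres_rel.cancel[of "p @ u" X "v @ q" x b R] by simp
next
  case (rel u v r s)
  then show ?case using pres_rel.rel[of "p @ u" X "v @ q" r s R] by simp
qed (auto intro: pres_rel.intros)

lemma pres_rel_append:
  assumes "(a, a') \<in> pres_rel X R" "(b, b') \<in> pres_rel X R"
  shows "(a @ b, a' @ b') \<in> pres_rel X R"
proof -
  have "(a @ b, a' @ b) \<in> pres_rel X R"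
    using pres_rel_context[OF assms(1), of "[]" b] assms pres_rel_words by fastforce
  moreover have "(a' @ b, a' @ b') \<in> pres_rel X R"
    using pres_rel_context[OF assms(2), of a' "[]"] assms pres_rel_words by fastforce
  ultimately show ?thesis by (rule pres_rel.trans)
qed

lemma pres_mult_class:
  assumes "a \<in> words X" "b \<in> words X"
  shows "(pres_rel X R `` {a}) \<otimes>\<^bsub>presented_group X R\<^esub> (pres_rel X R `` {b}) = pres_rel X R `` {a @ b}"
proof -
  have "congruent2 (pres_rel X R) (pres_rel X R) (\<lambda>a b. pres_rel X R `` {a @ b})"
    by (auto intro!: congruent2I' equiv_class_eq[OF equiv_pres_rel] pres_rel_append)
  from UN_equiv_class2[OF equiv_pres_rel equiv_pres_rel this assms]
  show ?thesis by (simp add: presented_group_def)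
qed

lemma pres_rel_inverse:
  "w \<in> words X \<Longrightarrow> (rev (map (\<lambda>(x, b). (x, \<not> b)) w) @ w, []) \<in> pres_rel X R"
proof (induction w)
  case Nil
  then show ?case by (simp add: pres_rel.refl)
next
  case (Cons a w)
  obtain x b where a: "a = (x, b)" by force
  let ?i = "rev (map (\<lambda>(x, b). (x, \<not> b)) w)"
  have i: "?i \<in> words X" using Cons.prems by (auto simp: words_def)
  have "(?i @ [(x, \<not> b), (x, \<not> \<not> b)] @ w, ?i @ w) \<in> pres_rel X R"
    using Cons.prems i a by (intro pres_rel.cancel) auto
  then show ?case using Cons a by (auto intro: pres_rel.trans)
qed

lemma group_presented_group: "group (presented_group X R)"
proof (rule groupI)
  let ?G = "presented_group X R"
  have car: "carrier ?G = words X // pres_rel X R"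
    and one: "\<one>\<^bsub>?G\<^esub> = pres_rel X R `` {[]}" by (simp_all add: presented_group_def)
  note m = pres_mult_class[of _ X _ R]
  show "\<one>\<^bsub>?G\<^esub> \<in> carrier ?G" by (simp add: car one quotientI)
  fix A assume "A \<in> carrier ?G"
  then obtain a where a: "a \<in> words X" "A = pres_rel X R `` {a}"
    unfolding car by (rule quotientE)
  show "\<one>\<^bsub>?G\<^esub> \<otimes>\<^bsub>?G\<^esub> A = A" using a by (simp add: one m)
  let ?i = "rev (map (\<lambda>(x, b). (x, \<not> b)) a)"
  have i: "?i \<in> words X" using a by (auto simp: words_def)
  have "pres_rel X R `` {?i @ a} = pres_rel X R `` {[]}"
    using a by (intro equiv_class_eq[OF equiv_pres_rel] pres_rel_inverse)
  then show "\<exists>B\<in>carrier ?G. B \<otimes>\<^bsub>?G\<^esub> A = \<one>\<^bsub>?G\<^esub>"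
    using a i by (intro bexI[of _ "pres_rel X R `` {?i}"]) (auto simp: one m car quotientI)
  fix B assume "B \<in> carrier ?G"
  then obtain b where b: "b \<in> words X" "B = pres_rel X R `` {b}"
    unfolding car by (rule quotientE)
  show "A \<otimes>\<^bsub>?G\<^esub> B \<in> carrier ?G" using a b by (simp add: m car quotientI)
  fix C assume "C \<in> carrier ?G"
  then obtain c where c: "c \<in> words X" "C = pres_rel X R `` {c}"
    unfolding car by (rule quotientE)
  show "A \<otimes>\<^bsub>?G\<^esub> B \<otimes>\<^bsub>?G\<^esub> C = A \<otimes>\<^bsub>?G\<^esub> (B \<otimes>\<^bsub>?G\<^esub> C)" using a b c by (simp add: m)
qed

datatype welded_gen = sigma nat | tau nat

definition welded_gens :: "nat \<Rightarrow> welded_gen set" where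
  "welded_gens n = sigma ` {1..n - 1} \<union> tau ` {1..n - 1}"

abbreviation (input) pos_word :: "'a list \<Rightarrow> 'a word" where
  "pos_word xs \<equiv> map (\<lambda>x. (x, True)) xs"

definition welded_relations :: "nat \<Rightarrow> (welded_gen word \<times> welded_gen word) set" where
  "welded_relations n =
    (\<Union>i\<in>{1..n - 1}. \<Union>k\<in>{k\<in>{1..n - 1}. \<bar>int i - int k\<bar> \<ge> 2}.
      {(pos_word [sigma i, sigma k], pos_word [sigma k, sigma i]),
       (pos_word [tau i, tau k], pos_word [tau k, tau i]),
       (pos_word [sigma i, tau k], pos_word [tau k, sigma i])})
    \<union> (\<Union>i\<in>{1..n - 2}.
      {(pos_word [sigma i, sigma (i + 1), sigma i], pos_word [sigma (i + 1), sigma i, sigma (i + 1)]),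
       (pos_word [tau i, tau (i + 1), tau i], pos_word [tau (i + 1), tau i, tau (i + 1)])})
    \<union> (\<Union>i\<in>{1..n - 1}. {(pos_word [tau i, tau i], [])})
    \<union> (\<Union>i\<in>{1..n - 2}.
      {(pos_word [tau i, sigma (i + 1), sigma i], pos_word [sigma (i + 1), sigma i, tau (i + 1)]),
       (pos_word [sigma i, tau (i + 1), tau i], pos_word [tau (i + 1), tau i, sigma (i + 1)])})"

definition wB :: "nat \<Rightarrow> welded_gen word set monoid" where
  "wB n = presented_group (welded_gens n) (welded_relations n)"

definition wB_gen :: "nat \<Rightarrow> welded_gen \<Rightarrow> welded_gen word set" where
  "wB_gen n = pres_gen (welded_gens n) (welded_relations n)"

text \<open>The ring \<open>\<int>[t\<^sup>\<plusminus>\<^sup>1]\<close> is the monoid algebra of the additive group of integers: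
  finitely supported maps from exponents to integer coefficients, multiplied by convolution.\<close>

type_synonym laurent = "int \<Rightarrow>\<^sub>0 int"

definition laurent_t :: laurent where
  "laurent_t = Poly_Mapping.single 1 1"

definition GL :: "nat \<Rightarrow> laurent mat monoid" where
  "GL n = units_of (ring_mat TYPE(laurent) n ())"

text \<open>Representations are homomorphisms to \<open>GL n\<close>. They are taken to be \<open>undefined\<close> outside the
  group, so that equality of functions is equality of homomorphisms and "the assignment
  \<open>f\<close> on generators defines a representation" reads \<open>\<exists>!\<rho>. extends_to_rep n f \<rho>\<close>.
  The product of the group, read from right to left, corresponds to the usual matrix product
  (matrices acting on column vectors).\<close>

definition representations :: "nat \<Rightarrow> (welded_gen word set \<Rightarrow> laurent mat) set" where
  "representations n = hom (wB n) (GL n) \<inter> extensional (carrier (wB n))"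

definition extends_to_rep ::
  "nat \<Rightarrow> (welded_gen \<Rightarrow> laurent mat) \<Rightarrow> (welded_gen word set \<Rightarrow> laurent mat) \<Rightarrow> bool" where
  "extends_to_rep n f \<rho> \<longleftrightarrow> \<rho> \<in> representations n \<and> (\<forall>g\<in>welded_gens n. \<rho> (wB_gen n g) = f g)"

definition equivalent_reps ::
  "nat \<Rightarrow> (welded_gen word set \<Rightarrow> laurent mat) \<Rightarrow> (welded_gen word set \<Rightarrow> laurent mat) \<Rightarrow> bool" where
  "equivalent_reps n \<rho> \<rho>' \<longleftrightarrow>
    (\<exists>P\<in>carrier (GL n). \<forall>x\<in>carrier (wB n). \<rho>' x = P \<otimes>\<^bsub>GL n\<^esub> \<rho> x \<otimes>\<^bsub>GL n\<^esub> inv\<^bsub>GL n\<^esub> P)"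

fun TYM_gen :: "nat \<Rightarrow> welded_gen \<Rightarrow> laurent mat" where
  "TYM_gen n (sigma i) =
    diag_block_mat [1\<^sub>m (i - 1), mat_of_rows_list 2 [[0, 1], [laurent_t, 0]], 1\<^sub>m (n - i - 1)]"
| "TYM_gen n (tau i) =
    diag_block_mat [1\<^sub>m (i - 1), mat_of_rows_list 2 [[0, 1], [1, 0]], 1\<^sub>m (n - i - 1)]"

definition TYM_dual_gen :: "nat \<Rightarrow> welded_gen \<Rightarrow> laurent mat" where
  "TYM_dual_gen n g = transpose_mat (inv\<^bsub>GL n\<^esub> (TYM_gen n g))"

end

theory Submission
  imports Defs "Jordan_Normal_Form.Determinant" "HOL-Combinatorics.Transposition"
begin

text \<open>Every generator goes to a weighted transposition matrix, and on such matrices the inverse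
  transpose only inverts the weight. Hence both assignments are the same family of matrices, taken
  at \<open>t\<close> and at \<open>t\<^sup>-\<^sup>1\<close>, and one verification of the relations, valid for
  every unit weight, serves both. The determinants \<open>-t\<close> and \<open>-t\<^sup>-\<^sup>1\<close> of the
  images of \<open>\<sigma>\<^sub>1\<close> show that the two representations are not equivalent.\<close>

section \<open>Homomorphisms from a presented group\<close>

definition (in monoid) eval_word :: "('c \<Rightarrow> 'a) \<Rightarrow> 'c word \<Rightarrow> 'a" where
  "eval_word f w = foldr (\<lambda>(x, b) a. (if b then f x else inv f x) \<otimes> a) w \<one>"

context group
begin

lemma eval_word_Nil [simp]: "eval_word f [] = \<one>"
  and eval_word_Cons [simp]:
    "eval_word f ((x, b) # w) = (if b then f x else inv f x) \<otimes> eval_word f w"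
  by (simp_all add: eval_word_def)

lemma eval_word_closed [simp]:
  "f \<in> X \<rightarrow> carrier G \<Longrightarrow> w \<in> words X \<Longrightarrow> eval_word f w \<in> carrier G"
  by (induction w) (auto simp: Pi_iff)

lemma eval_word_append:
  assumes "f \<in> X \<rightarrow> carrier G" "u \<in> words X" "v \<in> words X"
  shows "eval_word f (u @ v) = eval_word f u \<otimes> eval_word f v"
  using assms(2)
proof (induction u)
  case (Cons a u)
  obtain x b where "a = (x, b)" by force
  with Cons assms show ?case by (auto simp: m_assoc Pi_iff)
qed (use assms in auto)

text \<open>Equality in the group is itself reflexive, symmetric and transitive, so the induction
  only has to treat a cancelling pair and a relator in context. This makes evaluation well defined
  on classes of words.\<close>

lemma eval_word_cong:
  assumes f: "f \<in> X \<rightarrow> carrier G"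
    and R: "\<And>r s. (r, s) \<in> R \<Longrightarrow> r \<in> words X \<Longrightarrow> s \<in> words X \<Longrightarrow> eval_word f r = eval_word f s"
    and "(v, w) \<in> pres_rel X R"
  shows "eval_word f v = eval_word f w"
  using assms(3)
proof (induction rule: pres_rel.induct)
  case (cancel u v x b)
  then have "f x \<in> carrier G" "eval_word f v \<in> carrier G" using f by auto
  then have "eval_word f ([(x, b), (x, \<not> b)] @ v) = eval_word f v"
    by (cases b) (simp_all flip: m_assoc)
  with cancel show ?case
    by (simp add: eval_word_append[OF f] del: eval_word_Cons append.simps)
next
  case (rel u v r s)
  then show ?case using R f by (simp add: eval_word_append[OF f])
qed auto

text \<open>Von Dyck's theorem. Existence comes from evaluating representatives; uniqueness holds
  because a homomorphism is forced on positive letters, then on their inverses, then on all words,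
  and extensionality fixes it off the carrier.\<close>

lemma presented_group_universal:
  assumes f: "f \<in> X \<rightarrow> carrier G"
    and R: "\<And>r s. (r, s) \<in> R \<Longrightarrow> r \<in> words X \<Longrightarrow> s \<in> words X \<Longrightarrow> eval_word f r = eval_word f s"
  shows "\<exists>!\<phi>. \<phi> \<in> hom (presented_group X R) G \<inter> extensional (carrier (presented_group X R)) \<and>
    (\<forall>x\<in>X. \<phi> (pres_gen X R x) = f x)"
proof
  let ?P = "presented_group X R" and ?c = "\<lambda>w. pres_rel X R `` {w}"
  have car: "carrier ?P = words X // pres_rel X R" and one: "\<one>\<^bsub>?P\<^esub> = ?c []"
    by (simp_all add: presented_group_def)
  note m = pres_mult_class[of _ X _ R]
  \<comment> \<open>The choice of representative is harmless by \<open>eval_word_cong\<close>; the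
    restricted abstraction puts \<open>\<phi>\<close> into \<open>extensional\<close>.\<close>
  define \<phi> where "\<phi> = (\<lambda>A\<in>carrier ?P. eval_word f (SOME w. w \<in> A))"
  have \<phi>: "\<phi> (?c w) = eval_word f w" if w: "w \<in> words X" for w
  proof -
    have "w \<in> ?c w" using w by (simp add: pres_rel.refl)
    then have "(SOME v. v \<in> ?c w) \<in> ?c w" by (rule someI)
    then have "eval_word f w = eval_word f (SOME v. v \<in> ?c w)"
      using eval_word_cong[OF f R] by blast
    moreover have "?c w \<in> carrier ?P" unfolding car using w by (rule quotientI)
    ultimately show ?thesis by (simp add: \<phi>_def)
  qed
  have "\<phi> \<in> hom ?P G"
  proof (rule homI)
    fix A assume "A \<in> carrier ?P"
    then obtain a where a: "a \<in> words X" "A = ?c a" unfolding car by (rule quotientE)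
    then show "\<phi> A \<in> carrier G" using f by (simp add: \<phi>)
    fix B assume "B \<in> carrier ?P"
    then obtain b where "b \<in> words X" "B = ?c b" unfolding car by (rule quotientE)
    with a show "\<phi> (A \<otimes>\<^bsub>?P\<^esub> B) = \<phi> A \<otimes> \<phi> B" by (simp add: m \<phi> eval_word_append[OF f])
  qed
  moreover have "\<phi> (pres_gen X R x) = f x" if "x \<in> X" for x
    using that f by (auto simp: pres_gen_def \<phi> Pi_iff)
  ultimately show "\<phi> \<in> hom ?P G \<inter> extensional (carrier ?P) \<and> (\<forall>x\<in>X. \<phi> (pres_gen X R x) = f x)"
    by (simp add: \<phi>_def)
  fix \<psi> assume \<psi>: "\<psi> \<in> hom ?P G \<inter> extensional (carrier ?P) \<and> (\<forall>x\<in>X. \<psi> (pres_gen X R x) = f x)"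
  interpret h: group_hom ?P G \<psi>
    using \<psi> by (intro group_hom.intro group_hom_axioms.intro group_presented_group is_group) simp
  have \<psi>_pos: "\<psi> (?c [(x, True)]) = f x" if "x \<in> X" for x
    using \<psi> that by (simp add: pres_gen_def)
  \<comment> \<open>The letter \<open>(x, False)\<close> is only a formal inverse: cancellation
    makes its class the left inverse of the class of \<open>(x, True)\<close>, and
    \<open>\<psi>\<close> carries this over to the target group.\<close>
  have \<psi>_neg: "\<psi> (?c [(x, False)]) = inv f x" if x: "x \<in> X" for x
  proof -
    have "(([] @ [(x, False), (x, \<not> False)] @ [], [] @ []) :: 'c word \<times> 'c word) \<in> pres_rel X R"
      using x by (intro pres_rel.cancel) auto
    then have "?c [(x, False)] \<otimes>\<^bsub>?P\<^esub> ?c [(x, True)] = \<one>\<^bsub>?P\<^esub>"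
      using x by (simp add: m one equiv_class_eq[OF equiv_pres_rel])
    moreover have in_P: "?c [(x, b)] \<in> carrier ?P" for b
      unfolding car using x by (intro quotientI) simp
    ultimately have "\<psi> (?c [(x, False)]) \<otimes> \<psi> (?c [(x, True)]) = \<one>"
      by (metis h.hom_mult h.hom_one)
    with in_P show ?thesis
      using inv_equality h.hom_closed \<psi>_pos[OF x] by metis
  qed
  have "\<psi> (?c w) = eval_word f w" if "w \<in> words X" for w
    using that
  proof (induction w)
    case Nil
    then show ?case using h.hom_one by (simp add: one)
  next
    case (Cons a w)
    obtain x b where a: "a = (x, b)" by force
    have "?c (a # w) = ?c [(x, b)] \<otimes>\<^bsub>?P\<^esub> ?c w" using Cons.prems a by (simp add: m)
    moreover have "?c [(x, b)] \<in> carrier ?P" "?c w \<in> carrier ?P"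
      unfolding car using Cons.prems a by (auto intro!: quotientI)
    ultimately show ?case using Cons a \<psi>_pos \<psi>_neg by auto
  qed
  then have "\<psi> A = \<phi> A" if "A \<in> carrier ?P" for A
    using that \<phi> unfolding car by (auto elim!: quotientE)
  then show "\<psi> = \<phi>"
    using \<psi> by (intro extensionalityI[of _ "carrier ?P"]) (auto simp: \<phi>_def)
qed

end

section \<open>Monomial matrices\<close>

text \<open>Indexing by columns encodes the map sending the basis vector e_c to \<open>w c\<close>
  times e_(\<open>\<pi> c\<close>), so that products of matrices compose the index maps in the same
  order.\<close>

definition monomial_mat :: "nat \<Rightarrow> (nat \<Rightarrow> nat) \<Rightarrow> (nat \<Rightarrow> 'a :: comm_ring_1) \<Rightarrow> 'a mat" where
  "monomial_mat n \<pi> w = mat n n (\<lambda>(r, c). if r = \<pi> c then w c else 0)"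

lemma monomial_mat_carrier [simp]: "monomial_mat n \<pi> w \<in> carrier_mat n n"
  by (simp add: monomial_mat_def)

lemma monomial_mat_cong:
  "(\<And>c. c < n \<Longrightarrow> \<pi> c = \<rho> c \<and> w c = v c) \<Longrightarrow> monomial_mat n \<pi> w = monomial_mat n \<rho> v"
  by (auto simp: monomial_mat_def)

lemma one_mat_eq_monomial_mat: "1\<^sub>m n = monomial_mat n id (\<lambda>_. 1)"
  by (rule eq_matI) (auto simp: monomial_mat_def)

text \<open>Follow e_c through both maps: it picks up \<open>v c\<close> on moving to
  \<open>\<rho> c\<close>, then \<open>w (\<rho> c)\<close>. The bound on \<open>\<rho>\<close>
  ensures that the one contributing index of the sum lies in its range.\<close>

lemma monomial_mat_mult:
  assumes "\<And>c. c < n \<Longrightarrow> \<rho> c < n"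
  shows "monomial_mat n \<pi> w * monomial_mat n \<rho> v = monomial_mat n (\<pi> \<circ> \<rho>) (\<lambda>c. w (\<rho> c) * v c)"
proof (rule eq_matI)
  fix r c assume rc: "r < dim_row (monomial_mat n (\<pi> \<circ> \<rho>) (\<lambda>c. w (\<rho> c) * v c))"
    "c < dim_col (monomial_mat n (\<pi> \<circ> \<rho>) (\<lambda>c. w (\<rho> c) * v c))"
  then have rc: "r < n" "c < n" by (simp_all add: monomial_mat_def)
  have "(monomial_mat n \<pi> w * monomial_mat n \<rho> v) $$ (r, c)
      = (\<Sum>k = 0..<n. (if r = \<pi> k then w k else 0) * (if k = \<rho> c then v c else 0))"
    using rc by (simp add: monomial_mat_def scalar_prod_def)
  also have "\<dots> = (\<Sum>k = 0..<n. if k = \<rho> c then (if r = \<pi> k then w k else 0) * v c else 0)"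
    by (rule sum.cong) auto
  also have "\<dots> = (if r = \<pi> (\<rho> c) then w (\<rho> c) * v c else 0)"
    using assms rc by simp
  finally show "(monomial_mat n \<pi> w * monomial_mat n \<rho> v) $$ (r, c)
      = monomial_mat n (\<pi> \<circ> \<rho>) (\<lambda>c. w (\<rho> c) * v c) $$ (r, c)"
    using rc by (simp add: monomial_mat_def)
qed (simp_all add: monomial_mat_def)

lemma det_monomial_mat_id: "det (monomial_mat n id w) = (\<Prod>c<n. w c)"
proof -
  have "det (monomial_mat n id w) = prod_list (diag_mat (monomial_mat n id w))"
    by (rule det_upper_triangular[of _ n]) (auto simp: monomial_mat_def)
  also have "\<dots> = (\<Prod>c<n. w c)"
    by (simp add: prod_list_diag_prod monomial_mat_def atLeast0LessThan)
  finally show ?thesis .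
qed

section \<open>Weighted adjacent transpositions\<close>

text \<open>Generators are numbered from 1 but matrix indices from 0, so generator \<open>i\<close>
  swaps \<open>i - 1\<close> and \<open>i\<close>. The weight of column \<open>i - 1\<close> is the
  entry in row \<open>i\<close>, the lower left corner of the block.\<close>

definition adjacent_mat :: "nat \<Rightarrow> 'a :: comm_ring_1 \<Rightarrow> nat \<Rightarrow> 'a mat" where
  "adjacent_mat n u i = monomial_mat n (transpose (i - 1) i) (\<lambda>c. if c = i - 1 then u else 1)"

lemma adjacent_mat_carrier [simp]: "adjacent_mat n u i \<in> carrier_mat n n"
  by (simp add: adjacent_mat_def)

lemma diag_block_eq_adjacent_mat:
  assumes "i \<in> {1..n - 1}"
  shows "diag_block_mat [1\<^sub>m (i - 1), mat_of_rows_list 2 [[0, 1], [u, 0]], 1\<^sub>m (n - i - 1)]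
    = adjacent_mat n u i"
proof -
  define m where "m = i - 1"
  define k where "k = n - i - 1"
  have i: "i = Suc m" and n: "n = m + (2 + k)"
    using assms by (auto simp: m_def k_def)
  \<comment> \<open>An index lies in the first identity block, in one of the two middle positions,
    or in the last identity block at offset \<open>d\<close>; this explicit form lets simplification
    compute the block entries.\<close>
  have split: "r < m \<or> r = m \<or> r = Suc m \<or> (\<exists>d. r = Suc (Suc (m + d)))" for r
    by presburger
  have blocks: "diag_block_mat [1\<^sub>m m, mat_of_rows_list 2 [[0, 1], [u, 0]], 1\<^sub>m k] $$ (r, c)
      = adjacent_mat n u i $$ (r, c)" if "r < n" "c < n" for r c
    using split[of r] split[of c] that unfolding i n
    by (elim disjE exE)
      (simp_all add: adjacent_mat_def monomial_mat_def mat_of_rows_list_def Let_def transpose_def)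
  have "n - i - 1 = k" "i - 1 = m" by (simp_all add: m_def k_def)
  show ?thesis
    unfolding \<open>n - i - 1 = k\<close> \<open>i - 1 = m\<close>
  proof (rule eq_matI)
    show "dim_row (diag_block_mat [1\<^sub>m m, mat_of_rows_list 2 [[0, 1], [u, 0]], 1\<^sub>m k])
        = dim_row (adjacent_mat n u i)"
      "dim_col (diag_block_mat [1\<^sub>m m, mat_of_rows_list 2 [[0, 1], [u, 0]], 1\<^sub>m k])
        = dim_col (adjacent_mat n u i)"
      by (simp_all add: n dim_diag_block_mat mat_of_rows_list_def adjacent_mat_def monomial_mat_def
          del: diag_block_mat.simps)
  qed (rule blocks; simp add: adjacent_mat_def monomial_mat_def)
qed

lemma transpose_lt: "a < n \<Longrightarrow> b < n \<Longrightarrow> transpose a b c < n \<longleftrightarrow> c < (n :: nat)"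
  by (auto simp: transpose_def)

lemma adjacent_mat_mult_monomial_mat:
  assumes "i < n" "\<And>c. c < n \<Longrightarrow> \<rho> c < n"
  shows "adjacent_mat n u i * monomial_mat n \<rho> v
    = monomial_mat n (\<lambda>c. transpose (i - 1) i (\<rho> c)) (\<lambda>c. (if \<rho> c = i - 1 then u else 1) * v c)"
  using assms by (simp add: adjacent_mat_def monomial_mat_mult o_def)

lemma adjacent_mat_mult:
  assumes "i < n" "k < n"
  shows "adjacent_mat n u i * adjacent_mat n v k
    = monomial_mat n (\<lambda>c. transpose (i - 1) i (transpose (k - 1) k c))
      (\<lambda>c. (if transpose (k - 1) k c = i - 1 then u else 1) * (if c = k - 1 then v else 1))"
proof -
  have "k - 1 < n" using assms by simp
  then show ?thesis
    using assms unfolding adjacent_mat_def[of _ v]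
    by (simp add: adjacent_mat_mult_monomial_mat transpose_lt)
qed

lemma adjacent_mat_mult3:
  assumes "i < n" "k < n" "l < n"
  shows "adjacent_mat n u i * (adjacent_mat n v k * adjacent_mat n w l)
    = monomial_mat n (\<lambda>c. transpose (i - 1) i (transpose (k - 1) k (transpose (l - 1) l c)))
      (\<lambda>c. (if transpose (k - 1) k (transpose (l - 1) l c) = i - 1 then u else 1) *
        ((if transpose (l - 1) l c = k - 1 then v else 1) * (if c = l - 1 then w else 1)))"
proof -
  have "k - 1 < n" "l - 1 < n" using assms by simp_all
  then show ?thesis
    unfolding adjacent_mat_mult[OF assms(2,3)]
    using assms by (intro adjacent_mat_mult_monomial_mat) (simp_all add: transpose_lt)
qed

text \<open>Indices at distance at least two transpose disjoint pairs, so each column is moved or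
  weighted by at most one of the factors.\<close>

lemma adjacent_mat_commute:
  assumes "i \<in> {1..n - 1}" "k \<in> {1..n - 1}" "\<bar>int i - int k\<bar> \<ge> 2"
  shows "adjacent_mat n u i * adjacent_mat n v k = adjacent_mat n v k * adjacent_mat n u i"
proof -
  obtain m l where i: "i = Suc m" and k: "k = Suc l"
    using assms(1,2) by (cases i; cases k) auto
  have lt: "i < n" "k < n" and neq: "l \<noteq> m" "l \<noteq> Suc m" "m \<noteq> Suc l"
    using assms unfolding i k by auto
  show ?thesis
    unfolding adjacent_mat_mult[OF lt] adjacent_mat_mult[OF lt(2,1)]
  proof (rule monomial_mat_cong)
    fix c
    consider "c = m" | "c = Suc m" | "c = l" | "c = Suc l" | "c \<notin> {m, Suc m, l, Suc l}" by blast
    then show "transpose (i - 1) i (transpose (k - 1) k c) = transpose (k - 1) k (transpose (i - 1) i c) \<and>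
      (if transpose (k - 1) k c = i - 1 then u else 1) * (if c = k - 1 then v else 1)
      = (if transpose (i - 1) i c = k - 1 then v else 1) * (if c = i - 1 then u else 1)"
      using neq neq[symmetric] unfolding i k by cases (simp_all add: transpose_def)
  qed
qed

text \<open>The braid relations and the mixed relations are the instances in which the letters
  \<open>\<tau>\<close> carry the weight \<open>1\<close>.\<close>

lemma adjacent_mat_yang_baxter:
  assumes "i \<in> {1..n - 2}"
  shows "adjacent_mat n u i * (adjacent_mat n v (i + 1) * adjacent_mat n w i)
    = adjacent_mat n w (i + 1) * (adjacent_mat n v i * adjacent_mat n u (i + 1))"
proof -
  obtain m where i: "i = Suc m" using assms by (cases i) auto
  have lt: "i < n" "i + 1 < n" using assms by auto
  show ?thesis
    unfolding adjacent_mat_mult3[OF lt lt(1)] adjacent_mat_mult3[OF lt(2,1,2)]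
  proof (rule monomial_mat_cong, goal_cases)
    case (1 c)
    \<comment> \<open>Both sides swap \<open>m\<close> and \<open>m + 2\<close> and fix
      \<open>m + 1\<close>. On either side the columns \<open>m\<close>, \<open>m + 1\<close>,
      \<open>m + 2\<close> collect the weights \<open>v * w\<close>, \<open>u\<close> and 1, up to
      the order of the factors.\<close>
    consider "c = m" | "c = Suc m" | "c = Suc (Suc m)" | "c \<notin> {m, Suc m, Suc (Suc m)}" by blast
    then show ?case unfolding i by cases (simp_all add: transpose_def mult.commute)
  qed
qed

text \<open>The transposition cancels and leaves a diagonal matrix. Column \<open>i - 1\<close> is
  weighted by the right factor before the swap, column \<open>i\<close> by the left factor after it.
  This yields both the involution property and the determinant.\<close>

lemma adjacent_mat_mult_self:
  assumes "i \<in> {1..n - 1}"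
  shows "adjacent_mat n u i * adjacent_mat n v i
    = monomial_mat n id (\<lambda>c. if c = i - 1 then v else if c = i then u else 1)"
proof -
  obtain m where i: "i = Suc m" using assms by (cases i) auto
  have lt: "i < n" using assms by auto
  show ?thesis
    unfolding adjacent_mat_mult[OF lt lt] unfolding i
  proof (rule monomial_mat_cong, goal_cases)
    case (1 c)
    consider "c = m" | "c = Suc m" | "c \<notin> {m, Suc m}" by blast
    then show ?case by cases (simp_all add: transpose_def)
  qed
qed

lemma adjacent_mat_1_involution:
  assumes "i \<in> {1..n - 1}"
  shows "adjacent_mat n 1 i * adjacent_mat n 1 i = 1\<^sub>m n"
  unfolding adjacent_mat_mult_self[OF assms] one_mat_eq_monomial_mat
  by (rule monomial_mat_cong) simp

lemma adjacent_mat_inverse: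
  assumes "i \<in> {1..n - 1}" "u * v = 1"
  shows "adjacent_mat n u i * transpose_mat (adjacent_mat n v i) = 1\<^sub>m n"
    and "transpose_mat (adjacent_mat n v i) * adjacent_mat n u i = 1\<^sub>m n"
proof -
  obtain m where i: "i = Suc m" using assms by (cases i) auto
  have lt: "i < n" and m: "m < n" "Suc m < n" using assms unfolding i by auto
  let ?\<tau> = "transpose m (Suc m)" and ?w = "\<lambda>c. if c = Suc m then v else 1"
  \<comment> \<open>Transposing keeps the transposition, which is its own inverse, but moves the
    weight from column \<open>m\<close> to column \<open>Suc m\<close>. In the products below
    \<open>u\<close> and \<open>v\<close> therefore meet in one column and cancel.\<close>
  have dual: "transpose_mat (adjacent_mat n v i) = monomial_mat n ?\<tau> ?w"
    unfolding i
    by (intro eq_matI) (auto simp: adjacent_mat_def monomial_mat_def transpose_def split: if_splits)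
  have "adjacent_mat n u i * transpose_mat (adjacent_mat n v i)
      = monomial_mat n id (\<lambda>c. (if ?\<tau> c = m then u else 1) * ?w c)"
    unfolding dual using lt m by (simp add: adjacent_mat_mult_monomial_mat transpose_lt i id_def)
  also have "\<dots> = 1\<^sub>m n"
    unfolding one_mat_eq_monomial_mat using assms(2)
    by (intro monomial_mat_cong) (auto simp: transpose_eq_iff)
  finally show "adjacent_mat n u i * transpose_mat (adjacent_mat n v i) = 1\<^sub>m n" .
  have "transpose_mat (adjacent_mat n v i) * adjacent_mat n u i
      = monomial_mat n id (\<lambda>c. ?w (?\<tau> c) * (if c = m then u else 1))"
    unfolding dual using m by (simp add: adjacent_mat_def monomial_mat_mult transpose_lt i o_def id_def)
  also have "\<dots> = 1\<^sub>m n"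
    unfolding one_mat_eq_monomial_mat using assms(2)
    by (intro monomial_mat_cong) (auto simp: transpose_eq_iff mult.commute)
  finally show "transpose_mat (adjacent_mat n v i) * adjacent_mat n u i = 1\<^sub>m n" .
qed

text \<open>The factor \<open>det (adjacent_mat n 1 i)\<close> is the sign \<open>-1\<close>; it cancels when
  two weights are compared.\<close>

lemma det_adjacent_mat_mult:
  assumes "i \<in> {1..n - 1}"
  shows "det (adjacent_mat n u i) * det (adjacent_mat n 1 i) = u"
proof -
  have "det (adjacent_mat n u i) * det (adjacent_mat n 1 i) = det (adjacent_mat n u i * adjacent_mat n 1 i)"
    by (rule det_mult[of _ n, symmetric]) simp_all
  also have "\<dots> = (\<Prod>c<n. if c = i - 1 then 1 else if c = i then u else 1)"
    using assms by (simp add: adjacent_mat_mult_self det_monomial_mat_id)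
  also have "\<dots> = (\<Prod>c<n. if c = i then u else 1)"
    using assms by (intro prod.cong) auto
  also have "\<dots> = u"
    using assms by auto
  finally show ?thesis .
qed

section \<open>The two representations\<close>

lemma group_GL: "group (GL n)"
proof -
  interpret ring "ring_mat TYPE(laurent) n ()" by (rule ring_mat)
  show ?thesis unfolding GL_def by (rule units_group)
qed

lemma GL_simps [simp]:
  "A \<otimes>\<^bsub>GL n\<^esub> B = A * B"
  "\<one>\<^bsub>GL n\<^esub> = 1\<^sub>m n"
  by (simp_all add: GL_def units_of_mult units_of_one ring_mat_simps)

lemma carrier_GL:
  "carrier (GL n) = {A \<in> carrier_mat n n. \<exists>B\<in>carrier_mat n n. B * A = 1\<^sub>m n \<and> A * B = 1\<^sub>m n}"
  by (simp add: GL_def units_of_carrier Units_def ring_mat_simps)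

lemma det_conjugate_GL:
  assumes "P \<in> carrier (GL n)" "A \<in> carrier_mat n n"
  shows "det (P \<otimes>\<^bsub>GL n\<^esub> A \<otimes>\<^bsub>GL n\<^esub> inv\<^bsub>GL n\<^esub> P) = det A"
proof -
  interpret group "GL n" by (rule group_GL)
  let ?Q = "inv\<^bsub>GL n\<^esub> P"
  have "?Q \<in> carrier (GL n)" using assms by simp
  then have carr: "P \<in> carrier_mat n n" "?Q \<in> carrier_mat n n"
    using assms by (auto simp: carrier_GL)
  have "P * ?Q = 1\<^sub>m n" using r_inv[OF assms(1)] by simp
  then have "det P * det ?Q = 1" using carr by (metis det_mult det_one)
  moreover have "det (P * A * ?Q) = det A * (det P * det ?Q)"
    using carr assms by (simp add: det_mult[of _ n] ac_simps)
  ultimately show ?thesis by simp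
qed

fun welded_mat :: "nat \<Rightarrow> laurent \<Rightarrow> welded_gen \<Rightarrow> laurent mat" where
  "welded_mat n u (sigma i) = adjacent_mat n u i"
| "welded_mat n u (tau i) = adjacent_mat n 1 i"

lemma adjacent_mat_GL:
  assumes "i \<in> {1..n - 1}" "u * v = 1"
  shows "adjacent_mat n u i \<in> carrier (GL n)"
    and "inv\<^bsub>GL n\<^esub> (adjacent_mat n u i) = transpose_mat (adjacent_mat n v i)"
proof -
  note inverse = adjacent_mat_inverse[OF assms]
  show 1: "adjacent_mat n u i \<in> carrier (GL n)"
    unfolding carrier_GL using inverse
    by (auto intro!: bexI[of _ "transpose_mat (adjacent_mat n v i)"])
  have "transpose_mat (adjacent_mat n v i) \<in> carrier (GL n)"
    unfolding carrier_GL using inverse by (auto intro!: bexI[of _ "adjacent_mat n u i"])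
  with 1 show "inv\<^bsub>GL n\<^esub> (adjacent_mat n u i) = transpose_mat (adjacent_mat n v i)"
    using inverse by (intro group.inv_equality[OF group_GL]) auto
qed

lemma welded_mat_carrier [simp]: "welded_mat n u g \<in> carrier_mat n n"
  by (cases g) simp_all

lemma welded_gens_cases:
  assumes "g \<in> welded_gens n"
  obtains i where "g = sigma i" "i \<in> {1..n - 1}" | i where "g = tau i" "i \<in> {1..n - 1}"
  using assms unfolding welded_gens_def by blast

lemma welded_mat_relations:
  assumes "(r, s) \<in> welded_relations n"
  shows "monoid.eval_word (GL n) (welded_mat n u) r = monoid.eval_word (GL n) (welded_mat n u) s"
proof -
  interpret group "GL n" by (rule group_GL)
  \<comment> \<open>All relators are positive words of length 0, 2 or 3; these three evaluations
    turn each relation into an identity between matrix products without inverses.\<close>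
  have e0: "eval_word (welded_mat n u) [] = 1\<^sub>m n" by simp
  have e2: "eval_word (welded_mat n u) [(g, True), (h, True)] = welded_mat n u g * welded_mat n u h"
    for g h by (simp add: right_mult_one_mat[of _ n n])
  have e3: "eval_word (welded_mat n u) [(g, True), (h, True), (k, True)]
      = welded_mat n u g * (welded_mat n u h * welded_mat n u k)"
    for g h k by (simp add: right_mult_one_mat[of _ n n])
  show ?thesis
    using assms unfolding welded_relations_def
    by (elim UnE UN_E insertE emptyE;
        simp only: prod.inject list.map e0 e2 e3 welded_mat.simps mem_Collect_eq)
      (auto intro!: adjacent_mat_commute adjacent_mat_1_involution
        adjacent_mat_yang_baxter[simplified])
qed

text \<open>\<open>extends_to_rep\<close> looks at \<open>f\<close> only on the generators, so
  agreement with \<open>welded_mat\<close> there reduces the claim to the universal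
  property.\<close>

lemma ex1_extends_to_rep:
  assumes "u * v = 1" "\<And>g. g \<in> welded_gens n \<Longrightarrow> f g = welded_mat n u g"
  shows "\<exists>!\<rho>. extends_to_rep n f \<rho>"
proof -
  have "welded_mat n u g \<in> carrier (GL n)" if "g \<in> welded_gens n" for g
    using that adjacent_mat_GL(1)[OF _ assms(1)] adjacent_mat_GL(1)[of _ n 1 1]
    by (auto elim: welded_gens_cases)
  then have "welded_mat n u \<in> welded_gens n \<rightarrow> carrier (GL n)" by blast
  from group.presented_group_universal[OF group_GL this welded_mat_relations]
  have "\<exists>!\<rho>. extends_to_rep n (welded_mat n u) \<rho>"
    unfolding extends_to_rep_def representations_def wB_def wB_gen_def .
  moreover have "extends_to_rep n f = extends_to_rep n (welded_mat n u)"
    using assms(2) by (auto simp: extends_to_rep_def fun_eq_iff)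
  ultimately show ?thesis by simp
qed

theorem proposition1p5:
  fixes n :: nat
  assumes "n \<ge> 2"
  shows "(\<exists>!TYM. extends_to_rep n (TYM_gen n) TYM) \<and>
    (\<exists>!TYM_dual. extends_to_rep n (TYM_dual_gen n) TYM_dual) \<and>
    (\<forall>TYM TYM_dual. extends_to_rep n (TYM_gen n) TYM \<longrightarrow>
      extends_to_rep n (TYM_dual_gen n) TYM_dual \<longrightarrow>
      \<not> equivalent_reps n TYM_dual TYM)"
proof (intro conjI allI impI notI)
  \<comment> \<open>This is the inverse of \<open>laurent_t\<close>, the monomial of exponent -1;
    the two are told apart by their supports {1} and {-1}.\<close>
  define t' :: laurent where "t' = Poly_Mapping.single (- 1) 1"
  have t: "laurent_t * t' = 1" "t' * laurent_t = 1"
    by (simp_all add: laurent_t_def t'_def mult_single)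
  have "Poly_Mapping.keys laurent_t \<noteq> Poly_Mapping.keys t'"
    by (simp add: laurent_t_def t'_def)
  then have t_neq: "laurent_t \<noteq> t'" by metis
  have gen: "TYM_gen n g = welded_mat n laurent_t g" if "g \<in> welded_gens n" for g
    using that by (rule welded_gens_cases)
      (simp_all only: TYM_gen.simps welded_mat.simps diag_block_eq_adjacent_mat)
  have dual_gen: "TYM_dual_gen n g = welded_mat n t' g" if g: "g \<in> welded_gens n" for g
    using g unfolding TYM_dual_gen_def gen[OF g]
    \<comment> \<open>For \<open>sigma\<close> the inverse weight is \<open>t'\<close>; for
      \<open>tau\<close> it is 1, from the equation 1 * 1 = 1. The two transposes then
      cancel.\<close>
    by (rule welded_gens_cases)
      (simp_all only: welded_mat.simps adjacent_mat_GL(2)[OF _ t(1)]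
        adjacent_mat_GL(2)[OF _ mult_1_left[of 1]] Matrix.transpose_transpose)
  show "\<exists>!TYM. extends_to_rep n (TYM_gen n) TYM"
    using t(1) gen by (rule ex1_extends_to_rep)
  show "\<exists>!TYM_dual. extends_to_rep n (TYM_dual_gen n) TYM_dual"
    using t(2) dual_gen by (rule ex1_extends_to_rep)
  fix TYM TYM_dual
  assume TYM: "extends_to_rep n (TYM_gen n) TYM" and dual: "extends_to_rep n (TYM_dual_gen n) TYM_dual"
    and "equivalent_reps n TYM_dual TYM"
  then obtain P where P: "P \<in> carrier (GL n)" and conj:
    "\<And>x. x \<in> carrier (wB n) \<Longrightarrow> TYM x = P \<otimes>\<^bsub>GL n\<^esub> TYM_dual x \<otimes>\<^bsub>GL n\<^esub> inv\<^bsub>GL n\<^esub> P"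
    unfolding equivalent_reps_def by blast
  have det_eq: "det (welded_mat n laurent_t g) = det (welded_mat n t' g)" if g: "g \<in> welded_gens n" for g
  proof -
    have "wB_gen n g \<in> carrier (wB n)"
      using g by (auto simp: wB_def wB_gen_def pres_gen_def presented_group_def intro!: quotientI)
    moreover have "TYM (wB_gen n g) = welded_mat n laurent_t g"
      using TYM g gen by (simp add: extends_to_rep_def)
    moreover have "TYM_dual (wB_gen n g) = welded_mat n t' g"
      using dual g dual_gen by (simp add: extends_to_rep_def)
    moreover have "det (P \<otimes>\<^bsub>GL n\<^esub> welded_mat n t' g \<otimes>\<^bsub>GL n\<^esub> inv\<^bsub>GL n\<^esub> P) = det (welded_mat n t' g)"
      by (rule det_conjugate_GL[OF P welded_mat_carrier])
    ultimately show ?thesis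
      using conj[of "wB_gen n g"] by simp
  qed
  \<comment> \<open>Here \<open>n \<ge> 2\<close> enters: it provides the generator
    \<open>sigma 1\<close>, whose two images have different determinants.\<close>
  have 1: "1 \<in> {1..n - 1}" using assms by simp
  have "det (adjacent_mat n laurent_t 1) = det (adjacent_mat n t' 1)"
    using det_eq[of "sigma 1"] 1 by (simp add: welded_gens_def)
  then have "laurent_t = t'"
    using det_adjacent_mat_mult[OF 1] by metis
  with t_neq show False ..
qed

end
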